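(* Let $\{X_t\}_{t=0}^\infty$ be an irreducible aperiodic Markov chain on a finite state space $S$ with stationary distribution $\pi$, started from a fixed state $X_0 = s_0 \in S$. Let $\gamma \in (0,1/2]$ and $\theta \in [0,\pi_0]$, where $\pi_0 = 3.14159\ldots$ is the usual constant, and let $\Phi : S \to \mathbb{C}$, not identically zero, be such that for every $s\in S$ $$\mathbb{E}[\Phi(X_{t+1}) \mid X_t = s] = (1-\gamma)e^{i\theta}\,\Phi(s),$$ i.e. $(1-\gamma)e^{i\theta}$ is an eigenvalue of the transition matrix of the chain and $\Phi$ is a corresponding eigenvector. Let $R$ be a number such that $$R \geq \max_{s\in S} \mathbb{E}\big[\,|e^{-i\theta}\Phi(X_{t+1}) - \Phi(X_t)|^2 \,\big|\, X_t = s\big].$$ Fix $a>0$ and let $$T := \frac{\log|\Phi(s_0)| - \frac12 \log\!\big(\frac{4R}{\gamma a}\big)}{-\log(1-\gamma)} .$$ Then for all integers $t$ with $0\leq t \leq T$, $$\|P(X_t\in\cdot) - \pi\| \geq 1-a .$$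
   Context: Here $\|\mu-\nu\| = \frac12\sum_{s\in S}|\mu(s)-\nu(s)|$ denotes the total variation norm. Conditional expectations given $X_t=s$ mean one-step transition expectations from state $s$ and do not depend on $t$. If $\Phi(s_0)=0$, then $\log|\Phi(s_0)|=-\infty$ and $T=-\infty$. *)

theory Defs
  imports "HOL-Probability.Probability"
begin

text \<open>A Markov transition matrix on a finite state space is represented by its rows: \<open>K x\<close> is the
  distribution of the next state from \<open>x\<close>, so the entry at \<open>(x, y)\<close> is \<open>pmf (K x) y\<close>.\<close>

locale markov_chain = prob_space M
  for M :: "'w measure" and X :: "nat \<Rightarrow> 'w \<Rightarrow> 's :: finite" and K :: "'s \<Rightarrow> 's pmf" +
  assumes measurable_state: "X t \<in> measurable M (count_space UNIV)"
    and markov_property: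
      "prob {\<omega> \<in> space M. \<forall>i\<le>t. X i \<omega> = x i} > 0 \<Longrightarrow>
        \<P>(\<omega> in M. X (Suc t) \<omega> = y \<bar> \<forall>i\<le>t. X i \<omega> = x i) = pmf (K (x t)) y"

primrec kernel_power :: "('s \<Rightarrow> 's pmf) \<Rightarrow> nat \<Rightarrow> 's \<Rightarrow> 's pmf" where
  "kernel_power K 0 x = return_pmf x"
| "kernel_power K (Suc n) x = bind_pmf (kernel_power K n x) K"

definition irreducible_kernel :: "('s \<Rightarrow> 's pmf) \<Rightarrow> bool" where
  "irreducible_kernel K \<longleftrightarrow> (\<forall>x y. \<exists>n. pmf (kernel_power K n x) y > 0)"

definition aperiodic_kernel :: "('s \<Rightarrow> 's pmf) \<Rightarrow> bool" where
  "aperiodic_kernel K \<longleftrightarrow> (\<forall>x. Gcd {n. n \<ge> 1 \<and> pmf (kernel_power K n x) x > 0} = 1)"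

definition stationary_distribution :: "('s \<Rightarrow> 's pmf) \<Rightarrow> 's pmf \<Rightarrow> bool" where
  "stationary_distribution K \<pi> \<longleftrightarrow> bind_pmf \<pi> K = \<pi>"

definition total_variation :: "'s :: finite measure \<Rightarrow> 's measure \<Rightarrow> real" where
  "total_variation \<mu> \<nu> = 1 / 2 * (\<Sum>s\<in>UNIV. \<bar>measure \<mu> {s} - measure \<nu> {s}\<bar>)"

text \<open>The library has \<open>ln 0 = 0\<close>; here the logarithm of \<open>0\<close> is \<open>-\<infinity>\<close>. Only nonnegative arguments
  are meant.\<close>

definition ext_ln :: "real \<Rightarrow> ereal" where
  "ext_ln x = (if x = 0 then -\<infinity> else ereal (ln x))"

definition mixing_time_bound :: "('s \<Rightarrow> complex) \<Rightarrow> 's \<Rightarrow> real \<Rightarrow> real \<Rightarrow> real \<Rightarrow> ereal" where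
  "mixing_time_bound \<Phi> s\<^sub>0 \<gamma> R a =
     (ext_ln (cmod (\<Phi> s\<^sub>0)) - ereal (1 / 2 * ln (4 * R / (\<gamma> * a)))) / ereal (- ln (1 - \<gamma>))"

end

theory Submission
  imports Defs
begin

text \<open>
  The eigenfunction \<open>\<Phi>\<close>, seen as a statistic, tells the law of \<open>X\<^sub>t\<close> apart from \<open>\<pi>\<close> as long as its
  mean has not decayed to the size of its fluctuations.

  Put \<open>\<lambda> = (1 - \<gamma>) e\<^sup>i\<^sup>\<theta>\<close>. The mean of \<open>\<Phi>(X\<^sub>t)\<close> is \<open>\<lambda>\<^sup>t \<Phi>(s\<^sub>0)\<close>, of modulus \<open>(1 - \<gamma>)\<^sup>t |\<Phi>(s\<^sub>0)|\<close>.
  For the fluctuations, rotate each step back: with \<open>D = e\<^sup>-\<^sup>i\<^sup>\<theta> \<Phi>(X\<^sub>t\<^sub>+\<^sub>1) - \<Phi>(X\<^sub>t)\<close> the conditional mean of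
  \<open>D\<close> is \<open>-\<gamma> \<Phi>(X\<^sub>t)\<close>, a \<^emph>\<open>real\<close> multiple of \<open>\<Phi>(X\<^sub>t)\<close>. Expanding \<open>|\<Phi>(X\<^sub>t\<^sub>+\<^sub>1)|\<^sup>2 = |\<Phi>(X\<^sub>t) + D|\<^sup>2\<close> shows
  that one step takes the second moment \<open>v\<close> to at most \<open>(1 - 2 \<gamma>) v + R\<close> (\<open>second_moment_step\<close>). By
  iteration, the second moment at time \<open>t\<close> is at most \<open>(1 - 2 \<gamma>)\<^sup>t |\<Phi>(s\<^sub>0)|\<^sup>2 + R / (2 \<gamma>)\<close>. Since
  \<open>1 - 2 \<gamma> \<le> (1 - \<gamma>)\<^sup>2\<close>, subtracting the squared modulus of the mean removes the first term, and the
  variance is at most \<open>R / (2 \<gamma>)\<close> at every time (\<open>variance_kernel_power\<close>). Stationarity turns the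
  same one-step inequality into the bound \<open>R / (2 \<gamma>)\<close> for the second moment under \<open>\<pi>\<close>
  (\<open>second_moment_stationary\<close>).

  Let \<open>m\<close> be the mean at time \<open>t\<close>. The event \<open>|\<Phi>| \<ge> |m| / 2\<close> is unlikely under \<open>\<pi>\<close>, and its complement is
  unlikely under the law of \<open>X\<^sub>t\<close>; Chebyshev's inequality bounds each of the two probabilities by
  \<open>4 (R / (2 \<gamma>)) / |m|\<^sup>2\<close> (\<open>total_variation_ge_of_separated_means\<close>). The time bound says exactly that
  \<open>|m|\<^sup>2 \<ge> 4 R / (\<gamma> a)\<close>, so each probability is at most \<open>a / 2\<close>.
\<close>

section \<open>The law of the chain\<close>

lemma (in markov_chain) state_pred [measurable]: "Measurable.pred M (\<lambda>\<omega>. X t \<omega> = x)"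
  using measurable_state[of t] by measurable

lemma (in markov_chain) path_event_measurable:
  "{\<omega> \<in> space M. \<forall>i\<le>t. X i \<omega> = x i} \<in> sets M"
proof -
  have "{\<omega> \<in> space M. X i \<omega> = x i} \<in> sets M" for i
    by measurable
  then show ?thesis
    by measurable
qed

text \<open>The Markov property as a product formula, which also covers histories of probability \<open>0\<close>.\<close>

lemma (in markov_chain) path_event_step:
  "prob {\<omega> \<in> space M. X (Suc t) \<omega> = y \<and> (\<forall>i\<le>t. X i \<omega> = x i)} =
     prob {\<omega> \<in> space M. \<forall>i\<le>t. X i \<omega> = x i} * pmf (K (x t)) y"
proof (cases "prob {\<omega> \<in> space M. \<forall>i\<le>t. X i \<omega> = x i} > 0")
  case True
  then show ?thesis
    using markov_property[OF True, of y] unfolding cond_prob_def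
    by (simp add: divide_eq_eq mult.commute)
next
  case False
  then have "prob {\<omega> \<in> space M. \<forall>i\<le>t. X i \<omega> = x i} = 0"
    by (simp add: not_less measure_le_0_iff)
  moreover have "prob {\<omega> \<in> space M. X (Suc t) \<omega> = y \<and> (\<forall>i\<le>t. X i \<omega> = x i)} \<le>
      prob {\<omega> \<in> space M. \<forall>i\<le>t. X i \<omega> = x i}"
    by (rule finite_measure_mono) (auto simp: path_event_measurable)
  ultimately show ?thesis
    by (simp add: measure_le_0_iff)
qed

text \<open>The Markov property conditions on whole histories, so events are split according to the history
  up to time \<open>t\<close>. Histories are represented as extensional functions to make them finite in number.\<close>

lemma (in markov_chain) prob_sum_paths:
  assumes "Measurable.pred M Q"
  shows "prob {\<omega> \<in> space M. Q \<omega>} =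
    (\<Sum>p\<in>PiE {..t} (\<lambda>_. UNIV). prob {\<omega> \<in> space M. Q \<omega> \<and> (\<forall>i\<le>t. X i \<omega> = p i)})"
proof -
  let ?P = "PiE {..t} (\<lambda>_. UNIV :: 's set)"
  let ?A = "\<lambda>p. {\<omega> \<in> space M. Q \<omega> \<and> (\<forall>i\<le>t. X i \<omega> = p i)}"
  have cover: "{\<omega> \<in> space M. Q \<omega>} = (\<Union>p\<in>?P. ?A p)"
  proof (intro equalityI subsetI)
    fix \<omega> assume "\<omega> \<in> {\<omega> \<in> space M. Q \<omega>}"
    then have "\<omega> \<in> ?A (restrict (\<lambda>i. X i \<omega>) {..t})" "restrict (\<lambda>i. X i \<omega>) {..t} \<in> ?P"
      by auto
    then show "\<omega> \<in> (\<Union>p\<in>?P. ?A p)" by blast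
  qed auto
  have sets: "?A p \<in> sets M" for p
  proof -
    have "?A p = {\<omega> \<in> space M. Q \<omega>} \<inter> {\<omega> \<in> space M. \<forall>i\<le>t. X i \<omega> = p i}" by auto
    moreover have "{\<omega> \<in> space M. Q \<omega>} \<in> sets M" using assms by measurable
    ultimately show ?thesis using path_event_measurable[of t p] by (simp only: sets.Int)
  qed
  have disj: "disjoint_family_on ?A ?P"
    unfolding disjoint_family_on_def
  proof (intro ballI impI)
    fix p q assume pq: "p \<in> ?P" "q \<in> ?P" "p \<noteq> q"
    then obtain i where "i \<le> t" "p i \<noteq> q i"
      by (metis PiE_ext atMost_iff)
    then show "?A p \<inter> ?A q = {}" by auto
  qed
  have fin: "finite ?P" by (simp add: finite_PiE)
  show ?thesis
    unfolding cover by (rule finite_measure_finite_Union[OF fin _ disj]) (use sets in blast)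
qed

text \<open>Split by histories, apply the product formula, and group the histories by their last state.\<close>

lemma (in markov_chain) prob_state_Suc:
  "prob {\<omega> \<in> space M. X (Suc t) \<omega> = y} =
     (\<Sum>x\<in>UNIV. prob {\<omega> \<in> space M. X t \<omega> = x} * pmf (K x) y)"
proof -
  let ?P = "PiE {..t} (\<lambda>_. UNIV :: 's set)"
  let ?w = "\<lambda>p. prob {\<omega> \<in> space M. \<forall>i\<le>t. X i \<omega> = p i}"
  have fin: "finite ?P" by (simp add: finite_PiE)
  have now: "prob {\<omega> \<in> space M. X t \<omega> = x} = (\<Sum>p\<in>?P. if p t = x then ?w p else 0)" for x
  proof -
    have "prob {\<omega> \<in> space M. X t \<omega> = x \<and> (\<forall>i\<le>t. X i \<omega> = p i)} = (if p t = x then ?w p else 0)"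
      for p
    proof (cases "p t = x")
      case True
      then have "{\<omega> \<in> space M. X t \<omega> = x \<and> (\<forall>i\<le>t. X i \<omega> = p i)} =
          {\<omega> \<in> space M. \<forall>i\<le>t. X i \<omega> = p i}" by auto
      with True show ?thesis by simp
    next
      case False
      then have "{\<omega> \<in> space M. X t \<omega> = x \<and> (\<forall>i\<le>t. X i \<omega> = p i)} = {}" by auto
      then show ?thesis using False by (simp only: if_False measure_empty)
    qed
    then show ?thesis using prob_sum_paths[OF state_pred, of t x t] by simp
  qed
  have "prob {\<omega> \<in> space M. X (Suc t) \<omega> = y} = (\<Sum>p\<in>?P. ?w p * pmf (K (p t)) y)"
    using prob_sum_paths[OF state_pred, of "Suc t" y t] by (simp add: path_event_step)
  also have "\<dots> = (\<Sum>p\<in>?P. \<Sum>x\<in>UNIV. if p t = x then ?w p * pmf (K x) y else 0)"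
    by simp
  also have "\<dots> = (\<Sum>x\<in>UNIV. \<Sum>p\<in>?P. if p t = x then ?w p * pmf (K x) y else 0)"
    by (rule sum.swap)
  also have "\<dots> = (\<Sum>x\<in>UNIV. prob {\<omega> \<in> space M. X t \<omega> = x} * pmf (K x) y)"
    unfolding now sum_distrib_right by (intro sum.cong refl) auto
  finally show ?thesis .
qed

lemma (in markov_chain) measure_distr_state:
  assumes "AE \<omega> in M. X 0 \<omega> = s"
  shows "measure (distr M (count_space UNIV) (X t)) {x} = pmf (kernel_power K t s) x"
proof -
  have distr: "measure (distr M (count_space UNIV) (X t)) {x} = prob {\<omega> \<in> space M. X t \<omega> = x}"
    for t x
    using measurable_state[of t]
    by (subst measure_distr) (auto intro!: arg_cong[where f = prob])
  have "prob {\<omega> \<in> space M. X t \<omega> = x} = pmf (kernel_power K t s) x"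
  proof (induction t arbitrary: x)
    case 0
    show ?case
    proof (cases "x = s")
      case True
      have "prob {\<omega> \<in> space M. X 0 \<omega> = s} = 1"
        using assms by (subst prob_Collect_eq_1) auto
      with True show ?thesis by simp
    next
      case False
      have "prob {\<omega> \<in> space M. X 0 \<omega> = x} = 0"
        using assms False by (subst prob_Collect_eq_0) auto
      with False show ?thesis by (simp add: pmf_eq_0_set_pmf)
    qed
  next
    case (Suc t)
    show ?case
      unfolding prob_state_Suc Suc kernel_power.simps pmf_bind
      by (subst integral_measure_pmf[of UNIV]) auto
  qed
  with distr show ?thesis by simp
qed

section \<open>Separating two distributions by a statistic\<close>

text \<open>The two distributions have the same total mass, so their differences on \<open>A\<close> and on \<open>- A\<close> cancel,
  and the difference on \<open>A\<close> is half of a signed sum of all pointwise differences.\<close>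

lemma total_variation_ge_measure_diff:
  fixes p q :: "'s :: finite pmf"
  shows "measure p A - measure q A \<le> total_variation (measure_pmf p) (measure_pmf q)"
proof -
  let ?d = "\<lambda>s. pmf p s - pmf q s"
  have split: "(\<Sum>s\<in>UNIV. g s) = (\<Sum>s\<in>A. g s) + (\<Sum>s\<in>-A. g s)" for g :: "'s \<Rightarrow> real"
    using sum.union_disjoint[of A "- A" g] by simp
  have "sum ?d UNIV = 0"
    by (simp add: sum_subtractf sum_pmf_eq_1)
  then have "sum ?d A + sum ?d (- A) = 0"
    by (simp only: split)
  then have "2 * sum ?d A = sum ?d A - sum ?d (- A)" by simp
  also have "\<dots> \<le> (\<Sum>s\<in>A. \<bar>?d s\<bar>) + (\<Sum>s\<in>-A. \<bar>?d s\<bar>)"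
    using sum_abs[of ?d A] sum_abs[of ?d "-A"] by linarith
  also have "\<dots> = (\<Sum>s\<in>UNIV. \<bar>?d s\<bar>)"
    by (simp only: split)
  finally show ?thesis
    by (simp add: total_variation_def measure_measure_pmf_finite pmf.rep_eq[symmetric] sum_subtractf)
qed

lemma prob_norm_ge_le_second_moment:
  fixes p :: "'s :: finite pmf" and f :: "'s \<Rightarrow> 'b :: real_normed_vector"
  assumes "r > 0"
  shows "measure p {s. norm (f s) \<ge> r} \<le> measure_pmf.expectation p (\<lambda>s. (norm (f s))\<^sup>2) / r\<^sup>2"
proof -
  have "{s. norm (f s) \<ge> r} = {s. (norm (f s))\<^sup>2 \<ge> r\<^sup>2}"
    using assms by (auto simp: power2_le_iff_abs_le)
  then show ?thesis
    using integral_Markov_inequality_measure[of "measure_pmf p" "\<lambda>s. (norm (f s))\<^sup>2" "{}" "r\<^sup>2"] assms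
    by (simp add: integrable_measure_pmf_finite)
qed

text \<open>The sphere of radius \<open>norm m / 2\<close> around \<open>0\<close> separates the two distributions: a point inside it has
  distance at least \<open>norm m / 2\<close> from \<open>m\<close>. So Chebyshev's inequality with this radius applies around \<open>0\<close>
  for \<open>q\<close> and around \<open>m\<close> for \<open>p\<close>, each time with error \<open>4 * V / (norm m)\<^sup>2\<close>.\<close>

lemma total_variation_ge_of_separated_means:
  fixes p q :: "'s :: finite pmf" and f :: "'s \<Rightarrow> 'b :: real_normed_vector"
  assumes "measure_pmf.expectation p (\<lambda>s. (norm (f s - m))\<^sup>2) \<le> V"
    and "measure_pmf.expectation q (\<lambda>s. (norm (f s))\<^sup>2) \<le> V"
    and "m \<noteq> 0"
  shows "total_variation (measure_pmf p) (measure_pmf q) \<ge> 1 - 8 * V / (norm m)\<^sup>2"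
proof -
  define r where "r = norm m / 2"
  have r: "r > 0" "4 * r\<^sup>2 = (norm m)\<^sup>2"
    using assms(3) by (auto simp: r_def power2_eq_square)
  let ?A = "{s. norm (f s) \<ge> r}"
  have "measure q ?A \<le> V / r\<^sup>2"
    using prob_norm_ge_le_second_moment[OF r(1), of q f] assms(2)
    by (meson divide_right_mono order_trans zero_le_power2)
  moreover have "measure p (- ?A) \<le> V / r\<^sup>2"
  proof -
    have "measure p (- ?A) \<le> measure p {s. norm (f s - m) \<ge> r}"
    proof (rule measure_pmf.finite_measure_mono)
      show "- ?A \<subseteq> {s. norm (f s - m) \<ge> r}"
      proof
        fix s assume "s \<in> - ?A"
        with norm_triangle_sub[of m "f s"] show "s \<in> {s. norm (f s - m) \<ge> r}"
          by (simp add: r_def norm_minus_commute)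
      qed
    qed simp
    also have "\<dots> \<le> V / r\<^sup>2"
      using prob_norm_ge_le_second_moment[OF r(1), of p "\<lambda>s. f s - m"] assms(1)
      by (meson divide_right_mono order_trans zero_le_power2)
    finally show ?thesis .
  qed
  moreover have "measure p (- ?A) = 1 - measure p ?A"
    using measure_pmf.prob_compl[of ?A p] by (simp add: Compl_eq_Diff_UNIV)
  ultimately have "1 - 2 * (V / r\<^sup>2) \<le> measure p ?A - measure q ?A" by linarith
  also have "\<dots> \<le> total_variation (measure_pmf p) (measure_pmf q)"
    by (rule total_variation_ge_measure_diff)
  finally show ?thesis
    using r by (simp flip: r(2))
qed

section \<open>Moments of an eigenfunction along the chain\<close>

lemma expectation_bind_pmf_finite:
  fixes p :: "'s :: finite pmf" and f :: "'s \<Rightarrow> 'b :: {banach, second_countable_topology}"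
  shows "measure_pmf.expectation (bind_pmf p K) f =
    measure_pmf.expectation p (\<lambda>s. measure_pmf.expectation (K s) f)"
proof -
  have "measure_pmf.expectation (bind_pmf p K) f =
      (\<Sum>s\<in>UNIV. pmf p s *\<^sub>R measure_pmf.expectation (K s) f)"
    by (rule pmf_expectation_bind) auto
  also have "\<dots> = measure_pmf.expectation p (\<lambda>s. measure_pmf.expectation (K s) f)"
    by (rule integral_measure_pmf[symmetric]) auto
  finally show ?thesis .
qed

lemma expectation_norm_diff_sq:
  fixes p :: "'s :: finite pmf" and f :: "'s \<Rightarrow> complex"
  shows "measure_pmf.expectation p (\<lambda>s. (cmod (f s - c))\<^sup>2) =
    measure_pmf.expectation p (\<lambda>s. (cmod (f s))\<^sup>2)
      - 2 * Re (cnj c * measure_pmf.expectation p f) + (cmod c)\<^sup>2"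
proof -
  have "(cmod (f s - c))\<^sup>2 = (cmod (f s))\<^sup>2 - 2 * Re (cnj c * f s) + (cmod c)\<^sup>2" for s
    unfolding cmod_power2 by (simp add: power2_eq_square algebra_simps)
  then have "measure_pmf.expectation p (\<lambda>s. (cmod (f s - c))\<^sup>2) =
      measure_pmf.expectation p (\<lambda>s. (cmod (f s))\<^sup>2 - 2 * Re (cnj c * f s) + (cmod c)\<^sup>2)"
    by simp
  also have "\<dots> = measure_pmf.expectation p (\<lambda>s. (cmod (f s))\<^sup>2)
      - 2 * measure_pmf.expectation p (\<lambda>s. Re (cnj c * f s)) + (cmod c)\<^sup>2"
    by (simp add: integrable_measure_pmf_finite)
  also have "measure_pmf.expectation p (\<lambda>s. Re (cnj c * f s)) =
      Re (cnj c * measure_pmf.expectation p f)"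
    by (subst integral_Re) (simp_all add: integrable_measure_pmf_finite)
  finally show ?thesis .
qed

lemma variance_eq_second_moment_minus_mean_sq:
  fixes p :: "'s :: finite pmf" and f :: "'s \<Rightarrow> complex"
  defines "m \<equiv> measure_pmf.expectation p f"
  shows "measure_pmf.expectation p (\<lambda>s. (cmod (f s - m))\<^sup>2) =
    measure_pmf.expectation p (\<lambda>s. (cmod (f s))\<^sup>2) - (cmod m)\<^sup>2"
proof -
  have "Re (cnj m * m) = (cmod m)\<^sup>2"
    by (metis Re_complex_of_real complex_norm_square mult.commute)
  then show ?thesis
    unfolding expectation_norm_diff_sq m_def by simp
qed

text \<open>The condition \<open>\<gamma> \<le> 1 / 2\<close> keeps the contraction factor \<open>1 - 2 * \<gamma>\<close> of the second moment
  nonnegative, which iterating the one-step inequality requires.\<close>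

locale rotated_eigenfunction =
  fixes K :: "'s :: finite \<Rightarrow> 's pmf" and \<Phi> :: "'s \<Rightarrow> complex" and \<gamma> \<theta> R :: real
  assumes gamma: "0 < \<gamma>" "\<gamma> \<le> 1 / 2"
    and eigen: "\<And>s. measure_pmf.expectation (K s) \<Phi> = of_real (1 - \<gamma>) * cis \<theta> * \<Phi> s"
    and increment: "\<And>s. measure_pmf.expectation (K s)
      (\<lambda>s'. (cmod (cis (- \<theta>) * \<Phi> s' - \<Phi> s))\<^sup>2) \<le> R"
begin

abbreviation second_moment :: "'s pmf \<Rightarrow> real" where
  "second_moment p \<equiv> measure_pmf.expectation p (\<lambda>s. (cmod (\<Phi> s))\<^sup>2)"

lemma norm_eigenvalue: "cmod (of_real (1 - \<gamma>) * cis \<theta>) = 1 - \<gamma>"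
  unfolding norm_mult norm_of_real norm_cis using gamma by simp

lemma norm_mean:
  "cmod ((of_real (1 - \<gamma>) * cis \<theta>) ^ t * \<Phi> s) = (1 - \<gamma>) ^ t * cmod (\<Phi> s)"
  unfolding norm_mult[of "_ ^ t"] norm_power norm_eigenvalue ..

text \<open>After the rotation the conditional mean of \<open>\<Phi>\<close> is the real multiple \<open>(1 - \<gamma>) * \<Phi> s\<close> of \<open>\<Phi> s\<close>, so
  the cross term of the square is \<open>-2 * (1 - \<gamma>) * (cmod (\<Phi> s))\<^sup>2\<close>. Hence the increments of the rotated
  chain measure how far the second moment is from being contracted by the factor \<open>1 - 2 * \<gamma>\<close>.\<close>

lemma increment_sq:
  "measure_pmf.expectation (K s) (\<lambda>s'. (cmod (cis (- \<theta>) * \<Phi> s' - \<Phi> s))\<^sup>2) =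
     second_moment (K s) - (1 - 2 * \<gamma>) * (cmod (\<Phi> s))\<^sup>2"
proof -
  have "measure_pmf.expectation (K s) (\<lambda>s'. cis (- \<theta>) * \<Phi> s') =
      cis (- \<theta>) * cis \<theta> * (of_real (1 - \<gamma>) * \<Phi> s)"
    by (simp add: eigen)
  also have "\<dots> = of_real (1 - \<gamma>) * \<Phi> s"
    by (simp add: cis_mult)
  finally have mean: "measure_pmf.expectation (K s) (\<lambda>s'. cis (- \<theta>) * \<Phi> s') =
      of_real (1 - \<gamma>) * \<Phi> s" .
  have "cnj (\<Phi> s) * (of_real (1 - \<gamma>) * \<Phi> s) = of_real ((1 - \<gamma>) * (cmod (\<Phi> s))\<^sup>2)"
    using complex_norm_square[of "\<Phi> s"] by (simp add: ac_simps)
  then have "Re (cnj (\<Phi> s) * (of_real (1 - \<gamma>) * \<Phi> s)) = (1 - \<gamma>) * (cmod (\<Phi> s))\<^sup>2"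
    by (metis Re_complex_of_real)
  then show ?thesis
    unfolding expectation_norm_diff_sq mean by (simp add: norm_mult algebra_simps)
qed

lemma second_moment_step: "second_moment (bind_pmf p K) \<le> (1 - 2 * \<gamma>) * second_moment p + R"
proof -
  have int: "integrable (measure_pmf p) g" for g :: "'s \<Rightarrow> real"
    by (simp add: integrable_measure_pmf_finite)
  have "second_moment (bind_pmf p K) = measure_pmf.expectation p (\<lambda>s. second_moment (K s))"
    by (rule expectation_bind_pmf_finite)
  also have "\<dots> \<le> measure_pmf.expectation p (\<lambda>s. (1 - 2 * \<gamma>) * (cmod (\<Phi> s))\<^sup>2 + R)"
  proof (intro integral_mono int)
    show "second_moment (K s) \<le> (1 - 2 * \<gamma>) * (cmod (\<Phi> s))\<^sup>2 + R" for s
      using increment[of s] unfolding increment_sq by linarith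
  qed
  also have "\<dots> = (1 - 2 * \<gamma>) * second_moment p + R"
    by (simp add: int)
  finally show ?thesis .
qed

lemma mean_kernel_power:
  "measure_pmf.expectation (kernel_power K t s) \<Phi> = (of_real (1 - \<gamma>) * cis \<theta>) ^ t * \<Phi> s"
proof (induction t)
  case (Suc t)
  have "measure_pmf.expectation (kernel_power K (Suc t) s) \<Phi> =
      measure_pmf.expectation (kernel_power K t s) (\<lambda>s'. of_real (1 - \<gamma>) * cis \<theta> * \<Phi> s')"
    by (simp only: kernel_power.simps expectation_bind_pmf_finite eigen)
  also have "\<dots> = of_real (1 - \<gamma>) * cis \<theta> * measure_pmf.expectation (kernel_power K t s) \<Phi>"
    by (rule integral_mult_right_zero)
  finally show ?case
    by (simp only: Suc power_Suc mult.assoc)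
qed simp

text \<open>\<open>R / (2 * \<gamma>)\<close> is the fixed point of \<open>v \<mapsto> (1 - 2 * \<gamma>) * v + R\<close>, which makes the bound inductive.\<close>

lemma second_moment_kernel_power:
  "second_moment (kernel_power K t s) \<le> (1 - 2 * \<gamma>) ^ t * (cmod (\<Phi> s))\<^sup>2 + R / (2 * \<gamma>)"
proof (induction t)
  case 0
  have "0 \<le> R"
    using increment[of s] by (rule order_trans[rotated]) (rule Bochner_Integration.integral_nonneg, simp)
  then show ?case using gamma by simp
next
  case (Suc t)
  have "second_moment (kernel_power K (Suc t) s) \<le> (1 - 2 * \<gamma>) * second_moment (kernel_power K t s) + R"
    using second_moment_step by simp
  also have "\<dots> \<le> (1 - 2 * \<gamma>) * ((1 - 2 * \<gamma>) ^ t * (cmod (\<Phi> s))\<^sup>2 + R / (2 * \<gamma>)) + R"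
    using gamma by (intro add_right_mono mult_left_mono Suc) auto
  also have "\<dots> = (1 - 2 * \<gamma>) ^ Suc t * (cmod (\<Phi> s))\<^sup>2 + R / (2 * \<gamma>)"
    using gamma by (simp add: field_simps)
  finally show ?case .
qed

text \<open>The contribution of the starting state disappears because the second moment contracts by
  \<open>1 - 2 * \<gamma>\<close>, the squared modulus of the mean only by the larger factor \<open>(1 - \<gamma>)\<^sup>2\<close>.\<close>

lemma variance_kernel_power:
  "measure_pmf.expectation (kernel_power K t s)
     (\<lambda>x. (cmod (\<Phi> x - (of_real (1 - \<gamma>) * cis \<theta>) ^ t * \<Phi> s))\<^sup>2) \<le> R / (2 * \<gamma>)"
proof -
  let ?m = "(of_real (1 - \<gamma>) * cis \<theta>) ^ t * \<Phi> s"
  have "measure_pmf.expectation (kernel_power K t s) (\<lambda>x. (cmod (\<Phi> x - ?m))\<^sup>2) =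
      second_moment (kernel_power K t s) - (cmod ?m)\<^sup>2"
    using variance_eq_second_moment_minus_mean_sq[of "kernel_power K t s" \<Phi>]
    unfolding mean_kernel_power .
  moreover have "(1 - 2 * \<gamma>) ^ t * (cmod (\<Phi> s))\<^sup>2 \<le> (cmod ?m)\<^sup>2"
  proof -
    have "(1 - 2 * \<gamma>) ^ t \<le> ((1 - \<gamma>)\<^sup>2) ^ t"
      using gamma by (intro power_mono) (auto simp: power2_eq_square algebra_simps)
    moreover have "(cmod ?m)\<^sup>2 = ((1 - \<gamma>)\<^sup>2) ^ t * (cmod (\<Phi> s))\<^sup>2"
      unfolding norm_mean
      by (simp only: power_mult_distrib power_mult[symmetric] mult.commute[of t 2])
    ultimately show ?thesis
      by (simp add: mult_right_mono)
  qed
  ultimately show ?thesis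
    using second_moment_kernel_power[of t s] by linarith
qed

lemma second_moment_stationary:
  assumes "stationary_distribution K q"
  shows "second_moment q \<le> R / (2 * \<gamma>)"
proof -
  have "second_moment q \<le> (1 - 2 * \<gamma>) * second_moment q + R"
    using second_moment_step[of q] assms unfolding stationary_distribution_def by (simp only:)
  then have "second_moment q * (2 * \<gamma>) \<le> R"
    by (simp only: left_diff_distrib mult_1_left mult.commute[of "second_moment q"])
  then show ?thesis
    using gamma by (simp only: pos_le_divide_eq zero_less_mult_iff zero_less_numeral simp_thms)
qed

text \<open>Positivity is needed to exponentiate the time bound: \<open>ln\<close> sends \<open>0\<close> to \<open>0\<close>, so \<open>R = 0\<close> would give
  that bound an unintended value. The rotated increments cannot all vanish because their mean is
  \<open>- \<gamma> * \<Phi> s\<close>. Quantitatively, the variance in one step is nonnegative, so \<open>second_moment (K s)\<close> is at least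
  \<open>(1 - \<gamma>)\<^sup>2 * (cmod (\<Phi> s))\<^sup>2\<close>, and \<open>(1 - \<gamma>)\<^sup>2 - (1 - 2 * \<gamma>) = \<gamma>\<^sup>2\<close>.\<close>

lemma increment_bound_pos:
  assumes "\<Phi> s \<noteq> 0"
  shows "R > 0"
proof -
  let ?m = "of_real (1 - \<gamma>) * cis \<theta> * \<Phi> s"
  have "0 \<le> measure_pmf.expectation (K s) (\<lambda>x. (cmod (\<Phi> x - ?m))\<^sup>2)"
    by (rule Bochner_Integration.integral_nonneg) simp
  also have "\<dots> = second_moment (K s) - (cmod ?m)\<^sup>2"
    using variance_eq_second_moment_minus_mean_sq[of "K s" \<Phi>] unfolding eigen .
  also have "(cmod ?m)\<^sup>2 = (1 - \<gamma>)\<^sup>2 * (cmod (\<Phi> s))\<^sup>2"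
    by (simp only: norm_mult[of "of_real (1 - \<gamma>) * cis \<theta>"] norm_eigenvalue power_mult_distrib)
  finally have "\<gamma>\<^sup>2 * (cmod (\<Phi> s))\<^sup>2 \<le> R"
    using increment[of s] unfolding increment_sq by (simp add: power2_eq_square algebra_simps)
  moreover have "0 < \<gamma>\<^sup>2 * (cmod (\<Phi> s))\<^sup>2"
    using gamma assms by simp
  ultimately show ?thesis by linarith
qed

end

section \<open>The lower bound up to the time bound\<close>

text \<open>The time bound, exponentiated. If \<open>\<Phi> s = 0\<close>, it is \<open>- \<infinity>\<close> and no \<open>t\<close> satisfies the hypothesis.\<close>

lemma mean_sq_ge_of_le_mixing_time_bound:
  assumes "0 < \<gamma>" "\<gamma> < 1" "R > 0" "a > 0"
    and "ereal (real t) \<le> mixing_time_bound \<Phi> s \<gamma> R a"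
  shows "\<Phi> s \<noteq> 0" and "4 * R / (\<gamma> * a) \<le> ((1 - \<gamma>) ^ t * cmod (\<Phi> s))\<^sup>2"
proof -
  have l: "- ln (1 - \<gamma>) > 0"
    using assms by simp
  show nz: "\<Phi> s \<noteq> 0"
  proof
    assume "\<Phi> s = 0"
    then have "mixing_time_bound \<Phi> s \<gamma> R a = -\<infinity>"
      using l by (simp add: mixing_time_bound_def ext_ln_def)
    with assms(5) show False by simp
  qed
  have "real t \<le> (ln (cmod (\<Phi> s)) - 1 / 2 * ln (4 * R / (\<gamma> * a))) / (- ln (1 - \<gamma>))"
    using assms(5) nz l unfolding mixing_time_bound_def ext_ln_def by simp
  then have "real t * (- ln (1 - \<gamma>)) \<le> ln (cmod (\<Phi> s)) - 1 / 2 * ln (4 * R / (\<gamma> * a))"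
    using l by (simp only: pos_le_divide_eq)
  then have "ln (4 * R / (\<gamma> * a)) \<le> 2 * (real t * ln (1 - \<gamma>) + ln (cmod (\<Phi> s)))"
    by simp
  also have "\<dots> = ln (((1 - \<gamma>) ^ t * cmod (\<Phi> s))\<^sup>2)"
    using assms nz by (simp add: ln_realpow ln_mult)
  finally show "4 * R / (\<gamma> * a) \<le> ((1 - \<gamma>) ^ t * cmod (\<Phi> s))\<^sup>2"
    using assms nz by (subst (asm) ln_le_cancel_iff) auto
qed

theorem theorem4p1:
  fixes M :: "'w measure" and X :: "nat \<Rightarrow> 'w \<Rightarrow> 's :: finite" and K :: "'s \<Rightarrow> 's pmf"
    and \<pi> :: "'s pmf" and s\<^sub>0 :: 's and \<gamma> \<theta> R a :: real and \<Phi> :: "'s \<Rightarrow> complex"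
  assumes "markov_chain M X K"
    and "irreducible_kernel K"
    and "aperiodic_kernel K"
    and "stationary_distribution K \<pi>"
    and "AE \<omega> in M. X 0 \<omega> = s\<^sub>0"
    and "\<gamma> \<in> {0<..1 / 2}"
    and "\<theta> \<in> {0..pi}"
    and "\<exists>s. \<Phi> s \<noteq> 0"
    and "\<And>s. measure_pmf.expectation (K s) \<Phi> =
           of_real (1 - \<gamma>) * exp (\<i> * of_real \<theta>) * \<Phi> s"
    and "R \<ge> Max (range (\<lambda>s. measure_pmf.expectation (K s)
           (\<lambda>s'. (cmod (exp (- \<i> * of_real \<theta>) * \<Phi> s' - \<Phi> s))\<^sup>2)))"
    and "a > 0"
  shows "\<forall>t :: nat. ereal (real t) \<le> mixing_time_bound \<Phi> s\<^sub>0 \<gamma> R a \<longrightarrow>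
           total_variation (distr M (count_space UNIV) (X t)) (measure_pmf \<pi>) \<ge> 1 - a"
proof (intro allI impI)
  fix t :: nat
  assume t: "ereal (real t) \<le> mixing_time_bound \<Phi> s\<^sub>0 \<gamma> R a"
  interpret markov_chain M X K by fact
  have rot: "exp (\<i> * of_real \<theta>) = cis \<theta>" "exp (- \<i> * of_real \<theta>) = cis (- \<theta>)"
    by (simp_all add: cis_conv_exp)
  interpret rotated_eigenfunction K \<Phi> \<gamma> \<theta> R
  proof
    show "0 < \<gamma>" "\<gamma> \<le> 1 / 2" using assms(6) by auto
    show "measure_pmf.expectation (K s) \<Phi> = of_real (1 - \<gamma>) * cis \<theta> * \<Phi> s" for s
      using assms(9)[of s] unfolding rot .
    show "measure_pmf.expectation (K s) (\<lambda>s'. (cmod (cis (- \<theta>) * \<Phi> s' - \<Phi> s))\<^sup>2) \<le> R" for s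
      using assms(10) unfolding rot by (subst (asm) Max_le_iff) auto
  qed
  have "R > 0" using assms(8) increment_bound_pos by blast
  define m where "m = (of_real (1 - \<gamma>) * cis \<theta>) ^ t * \<Phi> s\<^sub>0"
  have "\<gamma> < 1" using gamma by simp
  note far = mean_sq_ge_of_le_mixing_time_bound[OF gamma(1) \<open>\<gamma> < 1\<close> \<open>R > 0\<close> \<open>a > 0\<close> t]
  have norm_m: "cmod m = (1 - \<gamma>) ^ t * cmod (\<Phi> s\<^sub>0)"
    by (simp only: m_def norm_mean)
  then have "cmod m > 0" using far(1) \<open>\<gamma> < 1\<close> by simp
  then have "m \<noteq> 0" by auto
  have "8 * (R / (2 * \<gamma>)) / (cmod m)\<^sup>2 \<le> a"
    using far(2) \<open>cmod m > 0\<close> \<open>a > 0\<close> gamma unfolding norm_m[symmetric] by (simp add: field_simps)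
  moreover have "1 - 8 * (R / (2 * \<gamma>)) / (cmod m)\<^sup>2 \<le>
      total_variation (measure_pmf (kernel_power K t s\<^sub>0)) (measure_pmf \<pi>)"
    using variance_kernel_power[of t s\<^sub>0] second_moment_stationary[OF assms(4)] \<open>m \<noteq> 0\<close>
    unfolding m_def by (rule total_variation_ge_of_separated_means)
  moreover have "total_variation (distr M (count_space UNIV) (X t)) (measure_pmf \<pi>) =
      total_variation (measure_pmf (kernel_power K t s\<^sub>0)) (measure_pmf \<pi>)"
    unfolding total_variation_def measure_distr_state[OF assms(5)] by (simp add: pmf.rep_eq)
  ultimately show "total_variation (distr M (count_space UNIV) (X t)) (measure_pmf \<pi>) \<ge> 1 - a"
    by linarith
qed

end
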